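(* Let $X$ be a real Hilbert space and let $M\in\mathbb{N}$. Let $N_*,N_m\subset\mathbb{N}$, $1\le m\le M$, be pairwise disjoint sets which form a decomposition of the natural numbers, i.e., $N_*\cup\bigcup_{m=1}^M N_m=\mathbb{N}$. Let $\{\phi_n\}_{n\in\mathbb{N}}$ be a complete orthonormal sequence in $X$ and let $\{f_n\}_{n\in\mathbb{N}}\subset X$ be a sequence, with $f_n\neq0$ for $n\in N_*$, that can be represented as $$f_n=\phi_n+\sum_{k=1}^\infty C^m_{n,k}T^m_k\phi_n\quad\text{for every } n\in N_m,\ 1\le m\le M,$$ and satisfies $$\Lambda_*:=\left(\sum_{n\in N_*}\left[1-\frac{\langle f_n,\phi_n\rangle^2}{\|f_n\|^2}\right]\right)^{1/2}<\infty.$$ Here $\{T^m_k\}$ is a family of bounded linear mappings from $X$ to itself with bounds $\|T^m_k\|_*\le t^m_k$ on the operator norm, and $\{C^m_{n,k}\}$ is a family of (real) constants with uniform bounds $|C^m_{n,k}|\le c^m_k$ (for all $n\in N_m$) that satisfy $$\Lambda_m:=\sum_{k=1}^\infty c^m_kt^m_k<\infty\quad\text{for } 1\le m\le M.$$ Then $\{f_n\}$ is a basis in $X$ provided that $$\Lambda_*^2+\sum_{m=1}^M\Lambda_m^2<1.$$ If, in addition, the subsequence $\{f_n\}_{n\in N_*}$ is bounded, then $\{f_n\}$ is a Riesz basis in $X$.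
   Context: $\langle\cdot,\cdot\rangle$ and $\|\cdot\|$ are the inner product and norm of $X$; $\|\cdot\|_*$ is the operator norm. "Basis" means Schauder basis. A sequence is a Riesz basis of a Hilbert space if it is the image of an orthonormal basis of that space under a linear homeomorphism.
   Formalization: In the Riesz basis claim, "bounded" is taken two-sidedly: the norms of f_n, n in N_*, are bounded above and also bounded away from zero. With an upper bound alone the claim fails, e.g. for N_* = ℕ and f_n = φ_n/(n+1). *)

theory Defs
  imports "HOL-Analysis.Analysis"
begin

text \<open>
  The set of natural numbers indexing sequences and series is the whole type \<^typ>\<open>nat\<close>, so that
  first terms have index 0.
\<close>

definition complete_orthonormal :: "(nat \<Rightarrow> 'a::real_inner) \<Rightarrow> bool"
  where "complete_orthonormal e \<longleftrightarrow>
    (\<forall>i j. e i \<bullet> e j = (if i = j then 1 else 0)) \<and> closure (span (range e)) = UNIV"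

definition schauder_basis :: "(nat \<Rightarrow> 'a::real_normed_vector) \<Rightarrow> bool"
  where "schauder_basis f \<longleftrightarrow> (\<forall>x. \<exists>!a. (\<lambda>n. a n *\<^sub>R f n) sums x)"

definition riesz_basis :: "(nat \<Rightarrow> 'a::{real_inner, complete_space}) \<Rightarrow> bool"
  where "riesz_basis f \<longleftrightarrow>
    (\<exists>e S S'. complete_orthonormal (e :: nat \<Rightarrow> 'a) \<and> linear S \<and> homeomorphism UNIV UNIV S S' \<and>
      (\<forall>n. f n = S (e n)))"

text \<open>
  Boundedness of a subsequence in the two-sided sense usual for bases: the norms are bounded, and
  also bounded away from zero. An upper bound alone does not suffice for a Riesz basis: if
  \<open>\<phi>\<close> is orthonormal then \<open>f n = \<phi> n / (n + 1)\<close> is a basis with norms at most 1, but a Riesz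
  basis has norms bounded away from zero.
\<close>

definition bounded_subsequence :: "(nat \<Rightarrow> 'a::real_normed_vector) \<Rightarrow> nat set \<Rightarrow> bool"
  where "bounded_subsequence f A \<longleftrightarrow>
    bounded (f ` A) \<and> (\<exists>\<delta>>0. \<forall>n\<in>A. \<delta> \<le> norm (f n))"

end

theory Submission
  imports Defs
begin

text \<open>
  The idea is that of Paley and Wiener: a sequence close enough to a complete orthonormal sequence
  \<open>\<phi>\<close> is its image under a small perturbation of the identity. Closeness is not measured
  vector by vector but through finite combinations of the differences \<open>v n\<close>: the norm of
  \<open>\<Sum>n\<in>F. a n *\<^sub>R v n\<close> should be at most \<open>r\<close> times the \<open>\<ell>\<^sup>2\<close>-norm of \<open>a\<close> on \<open>F\<close>, for one
  constant \<open>r < 1\<close>. Then \<open>E x = \<Sum>n. (x \<bullet> \<phi> n) *\<^sub>R v n\<close> defines an operator of norm at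
  most \<open>r\<close>, the operator \<open>S = 1 + E\<close> has a bounded inverse by Banach's fixed point theorem, and
  \<open>S (\<phi> n) = \<phi> n + v n\<close>.

  Being a Schauder basis does not change when the vectors are multiplied by nonzero scalars. This
  freedom is used on \<open>Nstar\<close>: there \<open>f n\<close> is replaced by the orthogonal projection of
  \<open>\<phi> n\<close> onto the line through \<open>f n\<close>, the multiple of \<open>f n\<close> nearest to \<open>\<phi> n\<close>. The square
  of its distance to \<open>\<phi> n\<close> is exactly the summand of \<open>Lstar\<^sup>2\<close>, so the Cauchy-Schwarz
  inequality gives the constant \<open>Lstar\<close> on \<open>Nstar\<close>
  (\<open>norm_projection_error\<close>, \<open>bessel_bound_on_square_summable\<close>). On \<open>N m\<close> a finite
  combination of the differences can be summed over \<open>n\<close> first, inside each operator \<open>T m k\<close>;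
  orthonormality of \<open>\<phi>\<close> then gives the constant \<open>L m\<close>
  (\<open>bessel_bound_on_operator_series\<close>). A second use of Cauchy-Schwarz, across the pieces of the
  partition, adds the squares of these constants (\<open>bessel_bound_on_Union\<close>), and the smallness
  hypothesis says that the result \<open>r\<close> is less than 1.

  Hence \<open>s n *\<^sub>R f n = S (\<phi> n)\<close> with nonzero scalars \<open>s n\<close>, which makes \<open>f\<close> a Schauder basis.
  If the norms of \<open>f n\<close> on \<open>Nstar\<close> lie between positive constants, then so do the numbers
  \<open>\<bar>s n\<bar>\<close>; the diagonal operator that sends \<open>\<phi> n\<close> to \<open>inverse (s n) *\<^sub>R \<phi> n\<close> is then a linear
  homeomorphism, and \<open>S\<close> composed with it maps \<open>\<phi>\<close> to \<open>f\<close>, so \<open>f\<close> is a Riesz basis.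
\<close>

section \<open>Bessel bounds\<close>

text \<open>
  For \<open>A = UNIV\<close> and \<open>0 \<le> B\<close> this is the usual notion of a Bessel sequence with bound
  \<open>B\<^sup>2\<close>, expressed on the synthesis side. It is stated relative to an index set \<open>A\<close> so that
  different parts of a sequence can be estimated by different means.
\<close>

definition bessel_bound_on :: "nat set \<Rightarrow> (nat \<Rightarrow> 'a::real_normed_vector) \<Rightarrow> real \<Rightarrow> bool"
  where "bessel_bound_on A v B \<longleftrightarrow>
    (\<forall>F a. finite F \<longrightarrow> F \<subseteq> A \<longrightarrow> norm (\<Sum>n\<in>F. a n *\<^sub>R v n) \<le> B * L2_set a F)"

lemma L2_set_weighted_le:
  assumes w: "\<And>n. n \<in> F \<Longrightarrow> \<bar>w n\<bar> \<le> b" and "0 \<le> b"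
  shows "L2_set (\<lambda>n. a n * w n) F \<le> b * L2_set a F"
proof -
  have "L2_set (\<lambda>n. a n * w n) F = L2_set (\<lambda>n. \<bar>w n\<bar> * \<bar>a n\<bar>) F"
    by (simp add: L2_set_def power_mult_distrib mult.commute)
  also have "\<dots> \<le> L2_set (\<lambda>n. b * \<bar>a n\<bar>) F"
    using w by (intro L2_set_mono) (auto intro!: mult_right_mono)
  also have "\<dots> = b * L2_set (\<lambda>n. \<bar>a n\<bar>) F"
    using \<open>0 \<le> b\<close> by (simp add: L2_set_right_distrib)
  also have "L2_set (\<lambda>n. \<bar>a n\<bar>) F = L2_set a F"
    by (simp add: L2_set_def)
  finally show ?thesis .
qed

lemma bessel_bound_onD:
  assumes "bessel_bound_on A v B" "finite F" "F \<subseteq> A"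
  shows "norm (\<Sum>n\<in>F. a n *\<^sub>R v n) \<le> B * L2_set a F"
  using assms by (simp add: bessel_bound_on_def)

lemma bessel_bound_on_square_summable:
  assumes "\<And>F. finite F \<Longrightarrow> F \<subseteq> A \<Longrightarrow> (\<Sum>n\<in>F. (norm (v n))\<^sup>2) \<le> B\<^sup>2" and "0 \<le> B"
  shows "bessel_bound_on A v B"
  unfolding bessel_bound_on_def
proof (intro allI impI)
  fix F and a :: "nat \<Rightarrow> real"
  assume F: "finite F" "F \<subseteq> A"
  have "norm (\<Sum>n\<in>F. a n *\<^sub>R v n) \<le> (\<Sum>n\<in>F. \<bar>a n\<bar> * \<bar>norm (v n)\<bar>)"
    by (rule order_trans[OF norm_sum]) simp
  also have "\<dots> \<le> L2_set a F * L2_set (\<lambda>n. norm (v n)) F"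
    by (rule L2_set_mult_ineq)
  also have "\<dots> \<le> L2_set a F * B"
  proof (rule mult_left_mono[OF _ L2_set_nonneg])
    show "L2_set (\<lambda>n. norm (v n)) F \<le> B"
      unfolding L2_set_def using assms F by (simp add: real_le_lsqrt sum_nonneg)
  qed
  finally show "norm (\<Sum>n\<in>F. a n *\<^sub>R v n) \<le> B * L2_set a F"
    by (simp add: mult.commute)
qed

text \<open>
  The triangle inequality over the pieces followed by the Cauchy-Schwarz inequality: since the
  pieces are disjoint, the squares of the \<open>\<ell>\<^sup>2\<close>-norms of the restrictions of \<open>a\<close> add up to
  the square of its \<open>\<ell>\<^sup>2\<close>-norm. So constants of pieces combine as the Euclidean norm of their
  vector, not as their sum.
\<close>

lemma bessel_bound_on_Union:
  assumes "finite I" and disj: "disjoint_family_on A I"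
    and bound: "\<And>i. i \<in> I \<Longrightarrow> bessel_bound_on (A i) v (l i)"
  shows "bessel_bound_on (\<Union>i\<in>I. A i) v (L2_set l I)"
  unfolding bessel_bound_on_def
proof (intro allI impI)
  fix F and a :: "nat \<Rightarrow> real"
  assume F: "finite F" "F \<subseteq> (\<Union>i\<in>I. A i)"
  have split: "(\<Sum>n\<in>F. g n) = (\<Sum>i\<in>I. \<Sum>n\<in>F \<inter> A i. g n)" for g :: "nat \<Rightarrow> 'c::comm_monoid_add"
  proof -
    have "F = (\<Union>i\<in>I. F \<inter> A i)"
      using F by blast
    then have "(\<Sum>n\<in>F. g n) = sum g (\<Union>i\<in>I. F \<inter> A i)"
      by simp
    also have "\<dots> = (\<Sum>i\<in>I. \<Sum>n\<in>F \<inter> A i. g n)"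
      using F disj \<open>finite I\<close> by (intro sum.UNION_disjoint) (auto simp: disjoint_family_on_def)
    finally show ?thesis .
  qed
  have "norm (\<Sum>n\<in>F. a n *\<^sub>R v n) \<le> (\<Sum>i\<in>I. norm (\<Sum>n\<in>F \<inter> A i. a n *\<^sub>R v n))"
    unfolding split by (rule norm_sum)
  also have "\<dots> \<le> (\<Sum>i\<in>I. l i * L2_set a (F \<inter> A i))"
    using F by (intro sum_mono bessel_bound_onD[OF bound]) auto
  also have "\<dots> \<le> (\<Sum>i\<in>I. \<bar>l i\<bar> * \<bar>L2_set a (F \<inter> A i)\<bar>)"
    by (intro sum_mono) (simp add: L2_set_nonneg mult_right_mono)
  also have "\<dots> \<le> L2_set l I * L2_set (\<lambda>i. L2_set a (F \<inter> A i)) I"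
    by (rule L2_set_mult_ineq)
  also have "L2_set (\<lambda>i. L2_set a (F \<inter> A i)) I = L2_set a F"
    unfolding L2_set_def by (simp add: split[of "\<lambda>n. (a n)\<^sup>2"] sum_nonneg)
  finally show "norm (\<Sum>n\<in>F. a n *\<^sub>R v n) \<le> L2_set l I * L2_set a F" .
qed

section \<open>Expansions in a complete orthonormal sequence\<close>

lemma orthonormal_inner:
  "complete_orthonormal e \<Longrightarrow> e i \<bullet> e j = (if i = j then 1 else 0)"
  by (simp add: complete_orthonormal_def)

lemma orthonormal_norm [simp]:
  "complete_orthonormal e \<Longrightarrow> norm (e n) = 1"
  by (simp add: norm_eq_sqrt_inner orthonormal_inner)

lemma orthonormal_norm_sum:
  assumes e: "complete_orthonormal e" and "finite F"
  shows "norm (\<Sum>n\<in>F. a n *\<^sub>R e n) = L2_set a F"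
  using \<open>finite F\<close>
  by (simp add: norm_eq_sqrt_inner L2_set_def inner_sum_left inner_sum_right
      orthonormal_inner[OF e] if_distrib power2_eq_square cong: if_cong)

text \<open>
  Pairing \<open>x\<close> with its partial expansion \<open>p\<close> gives the square of the norm of \<open>p\<close>, and by
  Cauchy-Schwarz at most the product of both norms.
\<close>

lemma bessel_inequality:
  assumes e: "complete_orthonormal e" and F: "finite F"
  shows "L2_set (\<lambda>n. x \<bullet> e n) F \<le> norm x"
proof -
  let ?l = "L2_set (\<lambda>n. x \<bullet> e n) F" and ?p = "\<Sum>n\<in>F. (x \<bullet> e n) *\<^sub>R e n"
  have "?l * ?l = x \<bullet> ?p"
    by (simp add: L2_set_def inner_sum_right sum_nonneg power2_eq_square)
  also have "\<dots> \<le> norm x * ?l"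
    using norm_cauchy_schwarz[of x ?p] by (simp add: orthonormal_norm_sum[OF e F])
  finally show ?thesis
    using L2_set_nonneg[of "\<lambda>n. x \<bullet> e n" F] by (cases "?l = 0") auto
qed

text \<open>
  The operator that sends each \<open>e n\<close> to \<open>v n\<close>; the perturbation \<open>E\<close> and all diagonal operators
  below have this form. The series converges for every \<open>x\<close> once \<open>v\<close> has a Bessel bound.
\<close>

definition synthesis :: "(nat \<Rightarrow> 'a) \<Rightarrow> (nat \<Rightarrow> 'a) \<Rightarrow> 'a \<Rightarrow> 'a::{real_inner, complete_space}"
  where "synthesis e v x = (\<Sum>n. (x \<bullet> e n) *\<^sub>R v n)"

text \<open>
  The coefficients of \<open>x\<close> are square summable by Bessel's inequality, and the Bessel bound of
  \<open>v\<close> turns this into the Cauchy property of the partial sums.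
\<close>

lemma synthesis_sums:
  fixes e v :: "nat \<Rightarrow> 'a::{real_inner, complete_space}"
  assumes e: "complete_orthonormal e" and v: "bessel_bound_on UNIV v B" and "0 \<le> B"
  shows "(\<lambda>n. (x \<bullet> e n) *\<^sub>R v n) sums synthesis e v x"
proof -
  let ?S = "\<lambda>N. \<Sum>n<N. (x \<bullet> e n) *\<^sub>R v n" and ?b = "\<lambda>n. (x \<bullet> e n)\<^sup>2"
  have "(\<Sum>n<N. ?b n) \<le> (norm x)\<^sup>2" for N
    using bessel_inequality[OF e, of "{..<N}" x]
    by (simp add: L2_set_def sqrt_le_D)
  then have "summable ?b"
    by (intro bounded_imp_summable[where B="(norm x)\<^sup>2"])
      (simp_all only: zero_le_power2 lessThan_Suc_atMost[symmetric])
  have "Cauchy ?S"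
  proof (rule CauchyI')
    fix \<epsilon> :: real assume "0 < \<epsilon>"
    \<comment> \<open>The denominator \<open>B + 1\<close> rather than \<open>B\<close> covers the case \<open>B = 0\<close>.\<close>
    define \<eta> where "\<eta> = (\<epsilon> / (B + 1))\<^sup>2"
    have "0 < \<eta>"
      using \<open>0 < \<epsilon>\<close> \<open>0 \<le> B\<close> by (simp add: \<eta>_def)
    then obtain N where N: "\<And>m n. N \<le> m \<Longrightarrow> norm (sum ?b {m..<n}) < \<eta>"
      using \<open>summable ?b\<close> unfolding summable_Cauchy by blast
    have "dist (?S m) (?S n) < \<epsilon>" if "N \<le> m" "m < n" for m n
    proof -
      have "{..<n} = {..<m} \<union> {m..<n}" "{..<m} \<inter> {m..<n} = {}"
        using that by auto
      then have "?S n = ?S m + (\<Sum>k=m..<n. (x \<bullet> e k) *\<^sub>R v k)"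
        by (simp add: sum.union_disjoint)
      then have "dist (?S m) (?S n) = norm (\<Sum>k=m..<n. (x \<bullet> e k) *\<^sub>R v k)"
        by (simp add: dist_norm)
      also have "\<dots> \<le> B * L2_set (\<lambda>k. x \<bullet> e k) {m..<n}"
        by (intro bessel_bound_onD[OF v]) auto
      also have "\<dots> \<le> B * (\<epsilon> / (B + 1))"
      proof (rule mult_left_mono[OF _ \<open>0 \<le> B\<close>])
        have "sum ?b {m..<n} \<le> \<eta>"
          using N[OF \<open>N \<le> m\<close>, of n] by simp
        then have "L2_set (\<lambda>k. x \<bullet> e k) {m..<n} \<le> sqrt \<eta>"
          unfolding L2_set_def by simp
        then show "L2_set (\<lambda>k. x \<bullet> e k) {m..<n} \<le> \<epsilon> / (B + 1)"
          using \<open>0 < \<epsilon>\<close> \<open>0 \<le> B\<close> by (simp add: \<eta>_def)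
      qed
      also have "\<dots> < \<epsilon>"
        using \<open>0 < \<epsilon>\<close> \<open>0 \<le> B\<close> by (simp add: field_simps)
      finally show ?thesis .
    qed
    then show "\<exists>N. \<forall>m\<ge>N. \<forall>n>m. dist (?S m) (?S n) < \<epsilon>"
      by blast
  qed
  then have "convergent ?S"
    by (simp add: Cauchy_convergent_iff)
  then show ?thesis
    unfolding synthesis_def by (intro summable_sums) (simp add: summable_iff_convergent)
qed

lemma synthesis_norm_le:
  fixes e v :: "nat \<Rightarrow> 'a::{real_inner, complete_space}"
  assumes e: "complete_orthonormal e" and v: "bessel_bound_on UNIV v B" and "0 \<le> B"
  shows "norm (synthesis e v x) \<le> B * norm x"
proof (rule LIMSEQ_le_const2)
  show "(\<lambda>N. norm (\<Sum>n<N. (x \<bullet> e n) *\<^sub>R v n)) \<longlonglongrightarrow> norm (synthesis e v x)"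
    using synthesis_sums[OF assms] unfolding sums_def by (rule tendsto_norm)
  have "norm (\<Sum>n<N. (x \<bullet> e n) *\<^sub>R v n) \<le> B * norm x" for N
    using bessel_bound_onD[OF v, of "{..<N}" "\<lambda>n. x \<bullet> e n"]
      mult_left_mono[OF bessel_inequality[OF e, of "{..<N}" x] \<open>0 \<le> B\<close>]
    by simp
  then show "\<exists>N0. \<forall>N\<ge>N0. norm (\<Sum>n<N. (x \<bullet> e n) *\<^sub>R v n) \<le> B * norm x"
    by blast
qed

lemma bounded_linear_synthesis:
  fixes e v :: "nat \<Rightarrow> 'a::{real_inner, complete_space}"
  assumes e: "complete_orthonormal e" and v: "bessel_bound_on UNIV v B" and "0 \<le> B"
  shows "bounded_linear (synthesis e v)"
proof (rule bounded_linear_intro)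
  note s = synthesis_sums[OF assms]
  show "synthesis e v (x + y) = synthesis e v x + synthesis e v y" for x y
    using sums_unique2[OF s[of "x + y"]] sums_add[OF s[of x] s[of y]]
    by (simp add: inner_add_left scaleR_add_left)
  show "synthesis e v (r *\<^sub>R x) = r *\<^sub>R synthesis e v x" for r x
    using sums_unique2[OF s[of "r *\<^sub>R x"]] sums_scaleR_right[OF s[of x], of r]
    by simp
  show "norm (synthesis e v x) \<le> norm x * B" for x
    using synthesis_norm_le[OF assms, of x] by (simp add: mult.commute)
qed

lemma synthesis_basis:
  assumes e: "complete_orthonormal e"
  shows "synthesis e v (e n) = v n"
proof -
  have "synthesis e v (e n) = (\<Sum>k. if k = n then v k else 0)"
    unfolding synthesis_def
    by (intro arg_cong[where f=suminf] ext) (auto simp: orthonormal_inner[OF e])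
  also have "\<dots> = v n"
    using sums_single[of n v] by (simp add: sums_iff)
  finally show ?thesis .
qed

lemma orthonormal_sums_inner:
  assumes e: "complete_orthonormal e" and s: "(\<lambda>n. b n *\<^sub>R e n) sums x"
  shows "x \<bullet> e n = b n"
proof -
  have "(\<lambda>k. (b k *\<^sub>R e k) \<bullet> e n) sums (x \<bullet> e n)"
    using bounded_linear.sums[OF bounded_linear_inner_left s] .
  moreover have "(\<lambda>k. (b k *\<^sub>R e k) \<bullet> e n) = (\<lambda>k. if k = n then b k else 0)"
    by (auto simp: orthonormal_inner[OF e])
  ultimately show ?thesis
    using sums_unique2 sums_single[of n b] by metis
qed

text \<open>
  The expansion converges to some vector, whose difference \<open>z\<close> from \<open>x\<close> is orthogonal to all
  \<open>e n\<close>. Hence the closed hyperplane orthogonal to \<open>z\<close> is the whole space, and \<open>z = 0\<close>.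
\<close>

lemma orthonormal_expansion:
  fixes e :: "nat \<Rightarrow> 'a::{real_inner, complete_space}"
  assumes e: "complete_orthonormal e"
  shows "(\<lambda>n. (x \<bullet> e n) *\<^sub>R e n) sums x"
proof -
  have "bessel_bound_on UNIV e 1"
    by (simp add: bessel_bound_on_def orthonormal_norm_sum[OF e])
  then have s: "(\<lambda>n. (x \<bullet> e n) *\<^sub>R e n) sums synthesis e e x"
    by (rule synthesis_sums[OF e]) simp
  define z where "z = x - synthesis e e x"
  have "e n \<in> {y. z \<bullet> y = 0}" for n
    using orthonormal_sums_inner[OF e s, of n] by (simp add: z_def inner_diff_left)
  moreover have "subspace {y. z \<bullet> y = 0}"
    by (simp add: subspace_hyperplane)
  ultimately have "span (range e) \<subseteq> {y. z \<bullet> y = 0}"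
    by (intro span_minimal) auto
  then have "closure (span (range e)) \<subseteq> {y. z \<bullet> y = 0}"
    by (rule closure_minimal) (rule closed_hyperplane)
  then have "z \<bullet> z = 0"
    using e unfolding complete_orthonormal_def by blast
  then show ?thesis
    using s by (simp add: z_def)
qed

section \<open>Linear homeomorphisms\<close>

definition linear_homeo :: "('a::real_normed_vector \<Rightarrow> 'a) \<Rightarrow> ('a \<Rightarrow> 'a) \<Rightarrow> bool"
  where "linear_homeo S S' \<longleftrightarrow> bounded_linear S \<and> bounded_linear S' \<and>
    (\<forall>x. S' (S x) = x) \<and> (\<forall>y. S (S' y) = y)"

lemma linear_homeo_compose:
  "linear_homeo S S' \<Longrightarrow> linear_homeo R R' \<Longrightarrow> linear_homeo (\<lambda>x. S (R x)) (\<lambda>x. R' (S' x))"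
  by (simp add: linear_homeo_def bounded_linear_compose)

text \<open>
  Solving \<open>x + E x = y\<close> means finding a fixed point of \<open>x \<mapsto> y - E x\<close>, which is a contraction
  of the complete space. The inverse is bounded since \<open>norm (x + E x) \<ge> (1 - r) * norm x\<close>.
\<close>

lemma linear_homeo_perturbed_identity:
  fixes E :: "'a::{real_normed_vector, complete_space} \<Rightarrow> 'a"
  assumes E: "bounded_linear E" and r: "0 \<le> r" "r < 1" and bound: "\<And>x. norm (E x) \<le> r * norm x"
  shows "\<exists>S'. linear_homeo (\<lambda>x. x + E x) S'"
proof -
  interpret E: bounded_linear E by (rule E)
  define S where "S x = x + E x" for x
  have "\<exists>!x. S x = y" for y
  proof -
    have "dist (y - E a) (y - E b) \<le> r * dist a b" for a b
      using bound[of "b - a"] by (simp add: dist_norm E.diff norm_minus_commute)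
    then have "\<exists>!x. y - E x = x"
      by (intro banach_fix_type[OF r]) blast
    moreover have "y - E x = x \<longleftrightarrow> S x = y" for x
      by (auto simp: S_def algebra_simps)
    ultimately show ?thesis
      by simp
  qed
  then have bij: "bij S"
    by (simp add: bij_iff)
  have lin: "linear S"
    unfolding S_def by (intro linear_compose_add linear_id[unfolded id_def] E.linear)
  have below: "norm x \<le> norm (S x) * (1 / (1 - r))" for x
  proof -
    have "norm x \<le> norm (S x) + norm (E x)"
      using norm_triangle_ineq4[of "S x" "E x"] by (simp add: S_def)
    then show ?thesis
      using bound[of x] r by (simp add: field_simps)
  qed
  have inv: "S (inv S y) = y" "inv S (S x) = x" for x y
    using bij by (auto simp: bij_def surj_f_inv_f)
  have "bounded_linear (inv S)"
  proof (rule bounded_linear_intro)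
    show "inv S (y + z) = inv S y + inv S z" for y z
      using inv linear_add[OF lin] by metis
    show "inv S (a *\<^sub>R y) = a *\<^sub>R inv S y" for a y
      using inv linear_cmul[OF lin] by metis
    show "norm (inv S y) \<le> norm y * (1 / (1 - r))" for y
      using below[of "inv S y"] by (simp add: inv)
  qed
  moreover have "bounded_linear S"
    unfolding S_def by (intro bounded_linear_add bounded_linear_ident E)
  ultimately have "linear_homeo S (inv S)"
    by (simp add: linear_homeo_def inv)
  then show ?thesis
    unfolding S_def by blast
qed

text \<open>
  A diagonal operator acts on the coefficients with respect to \<open>e\<close> by multiplication with
  \<open>d\<close>, so the operator with reciprocal entries inverts it; the two bounds make both operators
  bounded.
\<close>

lemma linear_homeo_diagonal:
  fixes e :: "nat \<Rightarrow> 'a::{real_inner, complete_space}"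
  assumes e: "complete_orthonormal e" and nz: "\<And>n. d n \<noteq> 0"
    and above: "\<And>n. \<bar>d n\<bar> \<le> K" and below: "\<And>n. \<bar>inverse (d n)\<bar> \<le> K'"
  shows "\<exists>D D'. linear_homeo D D' \<and> (\<forall>n. D (e n) = d n *\<^sub>R e n)"
proof -
  have B: "bessel_bound_on UNIV (\<lambda>n. h n *\<^sub>R e n) b" if h: "\<And>n. \<bar>h n\<bar> \<le> b" for h b
    unfolding bessel_bound_on_def
  proof (intro allI impI)
    fix F :: "nat set" and a :: "nat \<Rightarrow> real" assume "finite F"
    then have "norm (\<Sum>n\<in>F. a n *\<^sub>R h n *\<^sub>R e n) = L2_set (\<lambda>n. a n * h n) F"
      using orthonormal_norm_sum[OF e, of F "\<lambda>n. a n * h n"] by simp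
    also have "\<dots> \<le> b * L2_set a F"
      using h order_trans[OF abs_ge_zero h] by (intro L2_set_weighted_le) auto
    finally show "norm (\<Sum>n\<in>F. a n *\<^sub>R h n *\<^sub>R e n) \<le> b * L2_set a F" .
  qed
  define D where "D h = synthesis e (\<lambda>n. h n *\<^sub>R e n)" for h :: "nat \<Rightarrow> real"
  have bl: "bounded_linear (D h)" if "\<And>n. \<bar>h n\<bar> \<le> b" for h b
    unfolding D_def using that[of 0] by (intro bounded_linear_synthesis[OF e B[OF that]]) auto
  have coeff: "D h x \<bullet> e n = (x \<bullet> e n) * h n" if "\<And>n. \<bar>h n\<bar> \<le> b" for h b x n
  proof -
    have "0 \<le> b"
      using that[of 0] by simp
    from synthesis_sums[OF e B[OF that] this, of x] show ?thesis
      by (intro orthonormal_sums_inner[OF e]) (simp add: D_def)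
  qed
  have inv: "D g (D h x) = x" if h: "\<And>n. \<bar>h n\<bar> \<le> b" and gh: "\<And>n. h n * g n = 1" for g h b x
  proof -
    have "D g (D h x) = (\<Sum>n. (x \<bullet> e n) *\<^sub>R e n)"
      unfolding D_def[of g] synthesis_def coeff[OF h] by (simp add: mult.assoc gh)
    then show ?thesis
      using orthonormal_expansion[OF e, of x] by (simp add: sums_iff)
  qed
  have "linear_homeo (D d) (D (\<lambda>n. inverse (d n)))"
    unfolding linear_homeo_def
    using bl[OF above] bl[OF below] inv[OF above] inv[OF below] nz by simp
  moreover have "D d (e n) = d n *\<^sub>R e n" for n
    by (simp add: D_def synthesis_basis[OF e])
  ultimately show ?thesis
    by blast
qed

section \<open>Bases as images of a complete orthonormal sequence\<close>

lemma riesz_basis_linear_homeo: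
  assumes "complete_orthonormal e" "linear_homeo S S'" "\<And>n. f n = S (e n)"
  shows "riesz_basis f"
proof -
  have "homeomorphism UNIV UNIV S S'"
    using assms(2)
    by (auto simp: linear_homeo_def homeomorphism_def bounded_linear.linear
        intro!: linear_continuous_on surjI)
  then show ?thesis
    using assms unfolding riesz_basis_def linear_homeo_def bounded_linear_def by blast
qed

text \<open>
  Applying \<open>S'\<close> to an expansion of \<open>x\<close> in \<open>f\<close> gives the orthonormal expansion of \<open>S' x\<close>, so
  the coefficients have to be \<open>(S' x \<bullet> e n) / d n\<close>, and these do give an expansion.
\<close>

lemma schauder_basis_linear_homeo:
  fixes f e :: "nat \<Rightarrow> 'a::{real_inner, complete_space}"
  assumes e: "complete_orthonormal e" and S: "linear_homeo S S'"
    and d: "\<And>n. d n \<noteq> 0" and f: "\<And>n. f n = d n *\<^sub>R S (e n)"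
  shows "schauder_basis f"
  unfolding schauder_basis_def
proof (intro allI ex_ex1I)
  have S1: "bounded_linear S" and S2: "bounded_linear S'"
    and inv: "\<And>x. S' (S x) = x" "\<And>y. S (S' y) = y"
    using S by (auto simp: linear_homeo_def)
  interpret S: bounded_linear S by (rule S1)
  interpret S': bounded_linear S' by (rule S2)
  fix x
  have "(\<lambda>n. S ((S' x \<bullet> e n) *\<^sub>R e n)) sums S (S' x)"
    by (rule S.sums[OF orthonormal_expansion[OF e]])
  moreover have "S ((S' x \<bullet> e n) *\<^sub>R e n) = ((S' x \<bullet> e n) / d n) *\<^sub>R f n" for n
    using d[of n] by (simp add: f S.scaleR)
  ultimately show "\<exists>a. (\<lambda>n. a n *\<^sub>R f n) sums x"
    by (auto simp: inv)
  have coeff: "a n = (S' x \<bullet> e n) / d n" if "(\<lambda>n. a n *\<^sub>R f n) sums x" for a n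
  proof -
    have "(\<lambda>n. S' (a n *\<^sub>R f n)) sums S' x"
      by (rule S'.sums[OF that])
    then have "(\<lambda>n. (a n * d n) *\<^sub>R e n) sums S' x"
      by (simp add: f S'.scaleR inv)
    from orthonormal_sums_inner[OF e this, of n] show ?thesis
      using d[of n] by simp
  qed
  show "a = b" if "(\<lambda>n. a n *\<^sub>R f n) sums x" "(\<lambda>n. b n *\<^sub>R f n) sums x" for a b
    using coeff[OF that(1)] coeff[OF that(2)] by auto
qed

section \<open>The two kinds of perturbation\<close>

text \<open>
  Interchanging the finite sum over \<open>n\<close> with the series over \<open>k\<close> turns the combination into
  \<open>\<Sum>k. T k (\<Sum>n\<in>F. (a n * C n k) *\<^sub>R e n)\<close>. The argument of \<open>T k\<close> is an orthogonal
  sum of norm at most \<open>c k * L2_set a F\<close>. Estimating the \<open>v n\<close> one by one instead would only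
  yield a bound by the \<open>\<ell>\<^sup>1\<close>-norm of \<open>a\<close>.
\<close>

lemma bessel_bound_on_operator_series:
  fixes e :: "nat \<Rightarrow> 'a::{real_inner, complete_space}"
  assumes e: "complete_orthonormal e"
    and series: "\<And>n. n \<in> A \<Longrightarrow> (\<lambda>k. C n k *\<^sub>R T k (e n)) sums v n"
    and T: "\<And>k. bounded_linear (T k)" and t: "\<And>k. onorm (T k) \<le> t k"
    and c: "\<And>n k. n \<in> A \<Longrightarrow> \<bar>C n k\<bar> \<le> c k"
    and ct: "summable (\<lambda>k. c k * t k)"
  shows "bessel_bound_on A v (\<Sum>k. c k * t k)"
  unfolding bessel_bound_on_def
proof (intro allI impI)
  fix F and a :: "nat \<Rightarrow> real"
  assume F: "finite F" "F \<subseteq> A"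
  show "norm (\<Sum>n\<in>F. a n *\<^sub>R v n) \<le> (\<Sum>k. c k * t k) * L2_set a F"
  \<comment> \<open>If \<open>A\<close> is empty, \<open>c\<close> may take negative values; an index in \<open>F\<close> shows \<open>0 \<le> c k\<close>.\<close>
  proof (cases "F = {}")
    case True
    then show ?thesis by simp
  next
    case False
    then obtain p where "p \<in> A"
      using F by blast
    have c0: "0 \<le> c k" for k
      using c[OF \<open>p \<in> A\<close>, of k] by simp
    have t0: "0 \<le> t k" for k
      using onorm_pos_le[OF T, of k] t[of k] by simp
    define w where "w k = T k (\<Sum>n\<in>F. (a n * C n k) *\<^sub>R e n)" for k
    have w_le: "norm (w k) \<le> c k * t k * L2_set a F" for k
    proof -
      have "norm (\<Sum>n\<in>F. (a n * C n k) *\<^sub>R e n) \<le> c k * L2_set a F"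
        unfolding orthonormal_norm_sum[OF e F(1)] using c F c0 by (intro L2_set_weighted_le) auto
      then have "t k * norm (\<Sum>n\<in>F. (a n * C n k) *\<^sub>R e n) \<le> t k * (c k * L2_set a F)"
        using t0[of k] by (rule mult_left_mono)
      moreover have "norm (w k) \<le> t k * norm (\<Sum>n\<in>F. (a n * C n k) *\<^sub>R e n)"
        unfolding w_def by (rule order_trans[OF onorm[OF T]]) (simp add: t mult_right_mono)
      ultimately show ?thesis
        by (simp add: mult.commute mult.left_commute)
    qed
    have "(\<lambda>k. \<Sum>n\<in>F. a n *\<^sub>R C n k *\<^sub>R T k (e n)) sums (\<Sum>n\<in>F. a n *\<^sub>R v n)"
      using F by (intro sums_sum sums_scaleR_right series) auto
    moreover have "(\<Sum>n\<in>F. a n *\<^sub>R C n k *\<^sub>R T k (e n)) = w k" for k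
      using bounded_linear.linear[OF T, of k]
      by (simp add: w_def linear_sum linear_cmul)
    ultimately have "w sums (\<Sum>n\<in>F. a n *\<^sub>R v n)"
      by simp
    then have lim: "(\<lambda>K. norm (\<Sum>k<K. w k)) \<longlonglongrightarrow> norm (\<Sum>n\<in>F. a n *\<^sub>R v n)"
      unfolding sums_def by (rule tendsto_norm)
    have "norm (\<Sum>k<K. w k) \<le> (\<Sum>k. c k * t k) * L2_set a F" for K
    proof -
      have "norm (\<Sum>k<K. w k) \<le> (\<Sum>k<K. c k * t k * L2_set a F)"
        by (intro sum_norm_le w_le)
      also have "\<dots> = (\<Sum>k<K. c k * t k) * L2_set a F"
        by (simp add: sum_distrib_right)
      also have "\<dots> \<le> (\<Sum>k. c k * t k) * L2_set a F"
        using c0 t0 by (intro mult_right_mono sum_le_suminf[OF ct]) (auto simp: L2_set_nonneg)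
      finally show ?thesis .
    qed
    then show ?thesis
      by (intro LIMSEQ_le_const2[OF lim]) blast
  qed
qed

text \<open>
  The scaled vector is the orthogonal projection of \<open>u\<close> onto the line through \<open>x\<close>, so this is
  Pythagoras' theorem for \<open>u\<close>.
\<close>

lemma norm_projection_error:
  fixes x u :: "'a::real_inner"
  assumes "norm u = 1" "x \<noteq> 0"
  shows "(norm (((x \<bullet> u) / (norm x)\<^sup>2) *\<^sub>R x - u))\<^sup>2 = 1 - (x \<bullet> u)\<^sup>2 / (norm x)\<^sup>2"
proof -
  define s where "s = (x \<bullet> u) / (norm x)\<^sup>2"
  have uu: "u \<bullet> u = 1" and s: "s * (x \<bullet> x) = x \<bullet> u"
    using assms by (simp_all add: s_def power2_norm_eq_inner norm_eq_1)
  have "(norm (s *\<^sub>R x - u))\<^sup>2 = s * (s * (x \<bullet> x)) - 2 * s * (x \<bullet> u) + u \<bullet> u"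
    by (simp add: power2_norm_eq_inner inner_diff_left inner_diff_right inner_commute)
  also have "\<dots> = 1 - s * (x \<bullet> u)"
    unfolding s uu by simp
  finally show ?thesis
    by (simp add: s_def power2_eq_square)
qed

section \<open>The perturbation theorem\<close>

theorem theorem2p1:
  fixes \<phi> f :: "nat \<Rightarrow> 'a::{real_inner, complete_space}"
    and M :: nat
    and Nstar :: "nat set"
    and N :: "nat \<Rightarrow> nat set"
    and C :: "nat \<Rightarrow> nat \<Rightarrow> nat \<Rightarrow> real"
    and T :: "nat \<Rightarrow> nat \<Rightarrow> 'a \<Rightarrow> 'a"
    and c t :: "nat \<Rightarrow> nat \<Rightarrow> real"
    and Lstar :: real
    and L :: "nat \<Rightarrow> real"
  assumes disjoint_N: "disjoint_family_on N {1..M}"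
    and disjoint_Nstar: "\<And>m. m \<in> {1..M} \<Longrightarrow> Nstar \<inter> N m = {}"
    and cover: "Nstar \<union> (\<Union>m\<in>{1..M}. N m) = UNIV"
    and onb: "complete_orthonormal \<phi>"
    and nonzero: "\<And>n. n \<in> Nstar \<Longrightarrow> f n \<noteq> 0"
    and representation: "\<And>m n. m \<in> {1..M} \<Longrightarrow> n \<in> N m \<Longrightarrow>
          (\<lambda>k. C m n k *\<^sub>R T m k (\<phi> n)) sums (f n - \<phi> n)"
    and Lstar_finite: "(\<lambda>n. 1 - (f n \<bullet> \<phi> n)\<^sup>2 / (norm (f n))\<^sup>2) summable_on Nstar"
    and Lstar_eq: "Lstar = sqrt (\<Sum>\<^sub>\<infinity>n\<in>Nstar. 1 - (f n \<bullet> \<phi> n)\<^sup>2 / (norm (f n))\<^sup>2)"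
    and T_linear: "\<And>m k. m \<in> {1..M} \<Longrightarrow> bounded_linear (T m k)"
    and T_bound: "\<And>m k. m \<in> {1..M} \<Longrightarrow> onorm (T m k) \<le> t m k"
    and C_bound: "\<And>m n k. m \<in> {1..M} \<Longrightarrow> n \<in> N m \<Longrightarrow> \<bar>C m n k\<bar> \<le> c m k"
    and L_finite: "\<And>m. m \<in> {1..M} \<Longrightarrow> summable (\<lambda>k. c m k * t m k)"
    and L_eq: "\<And>m. m \<in> {1..M} \<Longrightarrow> L m = (\<Sum>k. c m k * t m k)"
    and small: "Lstar\<^sup>2 + (\<Sum>m = 1..M. (L m)\<^sup>2) < 1"
  shows "schauder_basis f \<and> (bounded_subsequence f Nstar \<longrightarrow> riesz_basis f)"
proof -
  \<comment> \<open>\<open>q n\<close> is the squared cosine of the angle between \<open>f n\<close> and \<open>\<phi> n\<close>, and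
    \<open>s n *\<^sub>R f n\<close> on \<open>Nstar\<close> is the projection of \<open>\<phi> n\<close> onto the line through \<open>f n\<close>.\<close>
  define q where "q n = (f n \<bullet> \<phi> n)\<^sup>2 / (norm (f n))\<^sup>2" for n
  define s where "s n = (if n \<in> Nstar then (f n \<bullet> \<phi> n) / (norm (f n))\<^sup>2 else 1)" for n
  define v where "v n = s n *\<^sub>R f n - \<phi> n" for n
  have v_star: "(norm (v n))\<^sup>2 = 1 - q n" if "n \<in> Nstar" for n
    using norm_projection_error[OF orthonormal_norm[OF onb] nonzero[OF that], of n] that
    by (simp add: v_def s_def q_def)
  have star0: "0 \<le> 1 - q n" if "n \<in> Nstar" for n
    using v_star[OF that] by (metis zero_le_power2)
  have star_sum: "(\<lambda>n. 1 - q n) summable_on Nstar" "Lstar = sqrt (\<Sum>\<^sub>\<infinity>n\<in>Nstar. 1 - q n)"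
    using Lstar_finite Lstar_eq by (simp_all add: q_def)
  have Lstar0: "0 \<le> Lstar" and Lstar_sq: "Lstar\<^sup>2 = (\<Sum>\<^sub>\<infinity>n\<in>Nstar. 1 - q n)"
    using star0 by (simp_all add: star_sum(2) infsum_nonneg)
  have star_le: "(\<Sum>n\<in>F. 1 - q n) \<le> Lstar\<^sup>2" if "finite F" "F \<subseteq> Nstar" for F
    unfolding Lstar_sq using that star0 by (intro finite_sum_le_infsum star_sum) auto
  have "bessel_bound_on Nstar v Lstar"
  proof (rule bessel_bound_on_square_summable[OF _ Lstar0])
    fix F assume F: "finite F" "F \<subseteq> Nstar"
    then have "(\<Sum>n\<in>F. (norm (v n))\<^sup>2) = (\<Sum>n\<in>F. 1 - q n)"
      by (intro sum.cong) (auto simp: v_star)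
    then show "(\<Sum>n\<in>F. (norm (v n))\<^sup>2) \<le> Lstar\<^sup>2"
      using star_le[OF F] by simp
  qed
  moreover have "bessel_bound_on (N m) v (L m)" if m: "m \<in> {1..M}" for m
    unfolding L_eq[OF m]
  proof (rule bessel_bound_on_operator_series[OF onb _ T_linear[OF m] T_bound[OF m] C_bound[OF m]
        L_finite[OF m]])
    fix n assume n: "n \<in> N m"
    then have "n \<notin> Nstar"
      using disjoint_Nstar[OF m] by blast
    then show "(\<lambda>k. C m n k *\<^sub>R T m k (\<phi> n)) sums v n"
      using representation[OF m n] by (simp add: v_def s_def)
  qed
  \<comment> \<open>Index 0 stands for \<open>Nstar\<close>, so that all pieces form one family.\<close>
  moreover define A where "A i = (if i = 0 then Nstar else N i)" for i
  moreover define l where "l i = (if i = 0 then Lstar else L i)" for i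
  ultimately have piece: "bessel_bound_on (A i) v (l i)" if "i \<in> {0..M}" for i
    using that by auto
  have "disjoint_family_on A {0..M}"
    unfolding disjoint_family_on_def
  proof (intro ballI impI)
    fix i j assume ij: "i \<in> {0..M}" "j \<in> {0..M}" "i \<noteq> j"
    consider "i = 0" "j \<in> {1..M}" | "j = 0" "i \<in> {1..M}" | "i \<in> {1..M}" "j \<in> {1..M}"
      using ij by fastforce
    then show "A i \<inter> A j = {}"
      using disjoint_N[unfolded disjoint_family_on_def] disjoint_Nstar ij
      by cases (simp_all add: A_def Int_commute)
  qed
  then have "bessel_bound_on (\<Union>i\<in>{0..M}. A i) v (L2_set l {0..M})"
    using piece by (intro bessel_bound_on_Union) auto
  moreover have split0: "{0..M} = insert 0 {1..M}"
    by auto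
  moreover have "(\<Union>i\<in>{0..M}. A i) = UNIV"
    using cover unfolding split0 A_def by auto
  moreover define r where "r = L2_set l {0..M}"
  ultimately have bessel: "bessel_bound_on UNIV v r"
    by simp
  have "(\<Sum>i\<in>{1..M}. (l i)\<^sup>2) = (\<Sum>m = 1..M. (L m)\<^sup>2)"
    by (intro sum.cong) (auto simp: l_def)
  then have "r = sqrt (Lstar\<^sup>2 + (\<Sum>m = 1..M. (L m)\<^sup>2))"
    unfolding r_def L2_set_def split0 by (simp add: l_def)
  then have r: "0 \<le> r" "r < 1"
    using small by (auto simp: sum_nonneg)
  obtain S' where S: "linear_homeo (\<lambda>x. x + synthesis \<phi> v x) S'"
    using linear_homeo_perturbed_identity[OF bounded_linear_synthesis[OF onb bessel r(1)] r
        synthesis_norm_le[OF onb bessel r(1)]] by blast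
  have S_basis: "\<phi> n + synthesis \<phi> v (\<phi> n) = s n *\<^sub>R f n" for n
    by (simp add: synthesis_basis[OF onb] v_def)
  have Lstar1: "Lstar\<^sup>2 < 1"
    using small sum_nonneg[of "{1..M}" "\<lambda>m. (L m)\<^sup>2"] by simp
  \<comment> \<open>A single summand is at most \<open>Lstar\<^sup>2 < 1\<close>, so the cosines stay away from 0; hence,
    for \<open>n \<in> Nstar\<close>, \<open>s n\<close> does not vanish, and \<open>\<bar>s n\<bar> * norm (f n)\<close> lies between
    \<open>sqrt (1 - Lstar\<^sup>2)\<close> and 1.\<close>
  have q_below: "1 - Lstar\<^sup>2 \<le> q n" if "n \<in> Nstar" for n
    using star_le[of "{n}"] that by simp
  have q_s: "q n = (s n * norm (f n))\<^sup>2" if "n \<in> Nstar" for n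
    using that nonzero[OF that] by (simp add: q_def s_def power2_eq_square field_simps)
  have s0: "s n \<noteq> 0" for n
    using q_below[of n] q_s[of n] Lstar1 by (cases "n \<in> Nstar") (auto simp: s_def)
  have f: "f n = inverse (s n) *\<^sub>R (\<phi> n + synthesis \<phi> v (\<phi> n))" for n
    unfolding S_basis using s0[of n] by simp
  have "schauder_basis f"
    by (rule schauder_basis_linear_homeo[OF onb S _ f]) (simp add: s0)
  moreover have "riesz_basis f" if "bounded_subsequence f Nstar"
  proof -
    from that obtain b \<delta> where b: "\<And>n. n \<in> Nstar \<Longrightarrow> norm (f n) \<le> b"
      and \<delta>: "0 < \<delta>" "\<And>n. n \<in> Nstar \<Longrightarrow> \<delta> \<le> norm (f n)"
      by (auto simp: bounded_subsequence_def bounded_iff)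
    define \<kappa> where "\<kappa> = sqrt (1 - Lstar\<^sup>2)"
    have \<kappa>: "0 < \<kappa>"
      using Lstar1 by (simp add: \<kappa>_def)
    have "\<bar>inverse (s n)\<bar> \<le> max 1 (b / \<kappa>)" for n
    proof (cases "n \<in> Nstar")
      case True
      have "\<kappa> \<le> sqrt ((s n * norm (f n))\<^sup>2)"
        unfolding \<kappa>_def q_s[OF True, symmetric] using q_below[OF True]
        by (rule real_sqrt_le_mono)
      also have "\<dots> = \<bar>s n\<bar> * norm (f n)"
        by (simp add: abs_mult)
      also have "\<dots> \<le> \<bar>s n\<bar> * b"
        using b[OF True] by (simp add: mult_left_mono)
      finally have "\<bar>inverse (s n)\<bar> \<le> b / \<kappa>"
        using \<kappa> s0[of n] by (simp add: field_simps)
      then show ?thesis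
        by simp
    qed (simp add: s_def)
    moreover have "\<bar>inverse (inverse (s n))\<bar> \<le> max 1 (1 / \<delta>)" for n
    proof (cases "n \<in> Nstar")
      case True
      have "(s n * norm (f n))\<^sup>2 \<le> 1"
        using star0[OF True] q_s[OF True] by simp
      then have "\<bar>s n\<bar> * norm (f n) \<le> 1"
        by (simp add: abs_square_le_1 abs_mult)
      moreover have "\<bar>s n\<bar> * \<delta> \<le> \<bar>s n\<bar> * norm (f n)"
        using \<delta>(2)[OF True] by (simp add: mult_left_mono)
      ultimately have "\<bar>s n\<bar> \<le> 1 / \<delta>"
        using \<delta>(1) by (simp add: field_simps)
      then show ?thesis
        by simp
    qed (simp add: s_def)
    ultimately have "\<exists>D D'. linear_homeo D D' \<and> (\<forall>n. D (\<phi> n) = inverse (s n) *\<^sub>R \<phi> n)"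
      by (intro linear_homeo_diagonal[OF onb]) (simp_all only: inverse_nonzero_iff_nonzero s0 not_False_eq_True)
    then obtain D D' where D: "linear_homeo D D'" "\<And>n. D (\<phi> n) = inverse (s n) *\<^sub>R \<phi> n"
      by blast
    have "f n = D (\<phi> n) + synthesis \<phi> v (D (\<phi> n))" for n
      unfolding D(2) f[of n]
      by (simp add: linear_cmul[OF bounded_linear.linear[OF bounded_linear_synthesis[OF onb bessel r(1)]]]
          scaleR_add_right)
    then show ?thesis
      by (rule riesz_basis_linear_homeo[OF onb linear_homeo_compose[OF S D(1)]])
  qed
  ultimately show ?thesis
    by blast
qed

end
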